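(* Let $0<p<1$, $A\in\mathbb{R}^{m\times n}$, $\bm{b}\in\mathbb{R}^m$ and $\sigma\ge0$ be such that $\{\bm{x}\in\mathbb{R}^n:\|A\bm{x}-\bm{b}\|_1\le\sigma\}\ne\emptyset$ and $\|\bm{b}\|_1>\sigma$. Suppose that $\bm{x}^*$ is a local minimizer of $$\min_{\bm{x}\in\mathbb{R}^n}\ \|\bm{x}\|_p^p\quad\text{s.t.}\quad\|A\bm{x}-\bm{b}\|_1\le\sigma .$$ Then there exists a $\lambda^*>0$ such that $\bm{x}^*$ is a local minimizer of $$\min_{\bm{x}\in\mathbb{R}^n}\ F_\lambda(\bm{x}):=\|\bm{x}\|_p^p+\lambda\,(\|A\bm{x}-\bm{b}\|_1-\sigma)_+$$ whenever $\lambda\ge\lambda^*$.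
   Context: $\|\bm{x}\|_p^p:=\sum_{i=1}^n|x_i|^p$ and $(\cdot)_+:=\max\{\cdot,0\}$. *)

theory Defs
  imports "HOL-Analysis.Analysis"
begin

(* The p-th power of the l_p quasi-norm; a zero component contributes 0, since 0 powr p = 0. *)
definition lp_pow :: "real \<Rightarrow> real ^ 'n \<Rightarrow> real"
  where "lp_pow p x = (\<Sum>i\<in>UNIV. \<bar>x $ i\<bar> powr p)"

definition l1_norm :: "real ^ 'm \<Rightarrow> real"
  where "l1_norm y = (\<Sum>i\<in>UNIV. \<bar>y $ i\<bar>)"

definition pos_part :: "real \<Rightarrow> real"
  where "pos_part t = max t 0"

definition l1_feasible :: "real ^ 'n ^ 'm \<Rightarrow> real ^ 'm \<Rightarrow> real \<Rightarrow> (real ^ 'n) set"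
  where "l1_feasible A b \<sigma> = {x. l1_norm (A *v x - b) \<le> \<sigma>}"

definition penalty_objective ::
    "real \<Rightarrow> real ^ 'n ^ 'm \<Rightarrow> real ^ 'm \<Rightarrow> real \<Rightarrow> real \<Rightarrow> real ^ 'n \<Rightarrow> real"
  where "penalty_objective p A b \<sigma> lam x
    = lp_pow p x + lam * pos_part (l1_norm (A *v x - b) - \<sigma>)"

definition local_minimizer_on :: "('a::metric_space \<Rightarrow> real) \<Rightarrow> 'a set \<Rightarrow> 'a \<Rightarrow> bool"
  where "local_minimizer_on f S x \<longleftrightarrow>
    x \<in> S \<and> (\<exists>\<epsilon>>0. \<forall>y\<in>S. dist y x < \<epsilon> \<longrightarrow> f x \<le> f y)"

end

theory Submission
  imports Defs
begin

text \<open>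
  The orthants in \<open>x\<close>, the orthants in \<open>A x - b\<close> and the sign of \<open>\<parallel>A x - b\<parallel>\<^sub>1 - \<sigma>\<close> cut the space
  into finitely many polyhedra. On each of them \<open>\<parallel>x\<parallel>\<^sub>p\<^sup>p\<close> is concave and the penalty term is affine,
  so \<open>F\<^sub>\<lambda>\<close> is concave for every \<open>\<lambda> \<ge> 0\<close>. Intersecting with a small box around \<open>x\<^sup>*\<close> gives
  polytopes, on which a concave function is bounded below by its values at the vertices. The finite
  set of all vertices does not depend on \<open>\<lambda>\<close>: at the feasible vertices \<open>F\<^sub>\<lambda> \<ge> F\<^sub>\<lambda>(x\<^sup>*)\<close> by local
  minimality, and at the infeasible ones by taking \<open>\<lambda>\<close> large.
\<close>

text \<open>The second-derivative test works on the open half-line. Since \<open>x < y\<close>, the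
  endpoint matters only for \<open>x = 0\<close>, where the claim reduces to
  \<open>t \<le> t powr p\<close> for \<open>0 < t < 1\<close>.\<close>

lemma concave_on_powr:
  fixes p :: real
  assumes "0 \<le> p" "p \<le> 1"
  shows "concave_on {0..} (\<lambda>x. x powr p)"
proof
  have pos: "concave_on {0<..} (\<lambda>x::real. x powr p)"
    by (rule f''_le0_imp_concave[where f' = "\<lambda>x. p * x powr (p - 1)"
          and f'' = "\<lambda>x. p * ((p - 1) * x powr (p - 2))"])
      (use assms in \<open>auto intro!: derivative_eq_intros
        simp: diff_diff_eq mult_le_0_iff\<close>)
  fix t x y :: real
  assume t: "0 < t" "t < 1" and xy: "x \<in> {0..}" "y \<in> {0..}" "x < y"
  show "(1 - t) * x powr p + t * y powr p \<le> ((1 - t) *\<^sub>R x + t *\<^sub>R y) powr p"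
  proof (cases "x = 0")
    case True
    have "t powr 1 \<le> t powr p"
      using t assms by (intro powr_mono') auto
    then show ?thesis
      using True t xy by (simp add: powr_mult mult_right_mono)
  next
    case False
    then show ?thesis
      using concave_onD[OF pos, of t x y] t xy by auto
  qed
qed auto

lemma concave_on_sum_fun:
  assumes "convex S" "\<And>i. i \<in> I \<Longrightarrow> concave_on S (f i)"
  shows "concave_on S (\<lambda>x. \<Sum>i\<in>I. f i x)"
  using assms(2)
  by (induction I rule: infinite_finite_induct)
    (auto simp: concave_on_const assms(1) intro: concave_on_add)

lemma concave_on_cong:
  assumes "\<And>x. x \<in> S \<Longrightarrow> f x = g x" "concave_on S g"
  shows "concave_on S f"
  using assms by (auto simp: concave_on_iff convexD)

text \<open>The convex function \<open>- f\<close> is bounded on the hull by its maximum over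
  \<open>V\<close>, which is attained because \<open>V\<close> is finite and nonempty.\<close>

lemma concave_on_convex_hull_vertex:
  assumes "finite V" "concave_on (convex hull V) f" "y \<in> convex hull V"
  obtains v where "v \<in> V" "f v \<le> f y"
proof -
  have "V \<noteq> {}"
    using assms(3) by auto
  have "- f y \<le> Max ((\<lambda>x. - f x) ` V)"
    by (rule convex_on_convex_hull_bound[rule_format, of V "\<lambda>x. - f x"])
      (use assms in \<open>auto simp: concave_on_def\<close>)
  moreover have "Max ((\<lambda>x. - f x) ` V) \<in> (\<lambda>x. - f x) ` V"
    using assms(1) \<open>V \<noteq> {}\<close> by (intro Max_in) auto
  ultimately show thesis
    using that by auto
qed

text \<open>By duality \<open>l\<close> is the inner product with the vector
  \<open>adjoint l 1\<close>, so the set is a half-space.\<close>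

lemma polyhedron_linear_ge:
  fixes l :: "'a::euclidean_space \<Rightarrow> real"
  assumes "linear l"
  shows "polyhedron {x. c \<le> l x}"
  using polyhedron_halfspace_ge[of c "adjoint l 1"] adjoint_works[OF assms, of _ 1]
  by (simp add: inner_commute)

definition sign_of :: "'i set \<Rightarrow> 'i \<Rightarrow> real"
  where "sign_of S i = (if i \<in> S then 1 else - 1)"

text \<open>Within a cell the signed sum equals \<open>l1_norm (A *v x - b)\<close>. Writing it with
  fixed signs keeps every condition affine; \<open>k = 1\<close> selects the side where the norm is
  at least \<open>\<sigma>\<close>, \<open>k = -1\<close> the side where it is at most
  \<open>\<sigma>\<close>.\<close>

definition sign_cell ::
    "real ^ 'n ^ 'm \<Rightarrow> real ^ 'm \<Rightarrow> real \<Rightarrow> 'n set \<Rightarrow> 'm set \<Rightarrow> real \<Rightarrow> (real ^ 'n) set"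
  where "sign_cell A b \<sigma> S T k = {x.
    (\<forall>i. 0 \<le> sign_of S i * x $ i) \<and>
    (\<forall>j. 0 \<le> sign_of T j * (A *v x - b) $ j) \<and>
    0 \<le> k * ((\<Sum>j\<in>UNIV. sign_of T j * (A *v x - b) $ j) - \<sigma>)}"

lemma abs_eq_sign_of: "0 \<le> sign_of S i * t \<Longrightarrow> \<bar>t\<bar> = sign_of S i * t"
  by (auto simp: sign_of_def split: if_splits)

lemma polyhedron_sign_cell: "polyhedron (sign_cell A b \<sigma> S T k)"
proof -
  let ?L = "\<lambda>x. \<Sum>j\<in>UNIV. sign_of T j * (A *v x) $ j"
  let ?c = "\<Sum>j\<in>UNIV. sign_of T j * b $ j"
  have 1: "polyhedron {x::real^_. 0 \<le> sign_of S i * x $ i}" for i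
    by (intro polyhedron_linear_ge linearI) (auto simp: algebra_simps)
  have 2: "polyhedron {x. sign_of T j * b $ j \<le> sign_of T j * (A *v x) $ j}" for j
    by (intro polyhedron_linear_ge linearI)
      (auto simp: algebra_simps matrix_vector_right_distrib matrix_vector_mult_scaleR)
  have 3: "polyhedron {x. k * (?c + \<sigma>) \<le> k * ?L x}"
    by (intro polyhedron_linear_ge linearI)
      (auto simp: algebra_simps matrix_vector_right_distrib matrix_vector_mult_scaleR
        sum.distrib sum_distrib_left)
  \<comment> \<open>The constants move to the left, so that each condition bounds a linear form from
    below.\<close>
  have "sign_cell A b \<sigma> S T k =
      \<Inter>(range (\<lambda>i. {x. 0 \<le> sign_of S i * x $ i})) \<inter>
      (\<Inter>(range (\<lambda>j. {x. sign_of T j * b $ j \<le> sign_of T j * (A *v x) $ j})) \<inter>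
      {x. k * (?c + \<sigma>) \<le> k * ?L x})"
    by (auto simp: sign_cell_def right_diff_distrib sum_subtractf algebra_simps)
  also have "polyhedron \<dots>"
    using 1 2 3 by (intro polyhedron_Int polyhedron_Inter) auto
  finally show ?thesis .
qed

lemma sign_cell_cover:
  obtains S T k where "k \<in> {-1, 1}" "x \<in> sign_cell A b \<sigma> S T k"
proof -
  define S where "S = {i. 0 \<le> x $ i}"
  define T where "T = {j. 0 \<le> (A *v x - b) $ j}"
  define r where "r = (\<Sum>j\<in>UNIV. sign_of T j * (A *v x - b) $ j) - \<sigma>"
  have "x \<in> sign_cell A b \<sigma> S T (if 0 \<le> r then 1 else - 1)"
    unfolding sign_cell_def mem_Collect_eq r_def[symmetric]
    by (auto simp: sign_of_def S_def T_def)
  then show thesis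
    using that by (metis insertCI)
qed

text \<open>Fixed signs turn \<open>lp_pow p\<close> into a sum of concave powers of nonnegative
  linear forms, and the positive part into an affine function; the weight \<open>lam \<ge> 0\<close>
  preserves concavity.\<close>

lemma concave_on_sign_cell:
  assumes "0 \<le> p" "p \<le> 1" "0 \<le> lam" "k \<in> {-1, 1}"
  shows "concave_on (sign_cell A b \<sigma> S T k) (penalty_objective p A b \<sigma> lam)"
proof -
  let ?C = "sign_cell A b \<sigma> S T k"
  let ?R = "\<lambda>x. (\<Sum>j\<in>UNIV. sign_of T j * (A *v x - b) $ j) - \<sigma>"
  have cvx: "convex ?C"
    by (rule polyhedron_imp_convex[OF polyhedron_sign_cell])
  have "concave_on ?C (\<lambda>x. (sign_of S i * x $ i) powr p)" for i
    unfolding concave_on_iff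
  proof (intro conjI cvx ballI allI impI)
    fix x y and u v :: real
    assume "x \<in> ?C" "y \<in> ?C" "0 \<le> u" "0 \<le> v" "u + v = 1"
    then show "u * (sign_of S i * x $ i) powr p + v * (sign_of S i * y $ i) powr p
        \<le> (sign_of S i * (u *\<^sub>R x + v *\<^sub>R y) $ i) powr p"
      using concave_on_powr[OF assms(1,2), unfolded concave_on_iff, THEN conjunct2, rule_format,
          of "sign_of S i * x $ i" "sign_of S i * y $ i" u v]
      by (simp add: sign_cell_def algebra_simps)
  qed
  then have "concave_on ?C (\<lambda>x. \<Sum>i\<in>UNIV. (sign_of S i * x $ i) powr p)"
    by (intro concave_on_sum_fun cvx)
  then have lp: "concave_on ?C (lp_pow p)"
    by (rule concave_on_cong[rotated])
      (auto simp: lp_pow_def sign_cell_def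
        intro!: sum.cong arg_cong[where f = "\<lambda>t. t powr p"] abs_eq_sign_of)
  have R: "concave_on ?C ?R"
    unfolding concave_on_iff
  proof (intro conjI cvx ballI allI impI)
    fix x y and u v :: real
    assume uv: "u + v = 1"
    have "u * b $ j + v * b $ j = b $ j" for j
      using uv by (metis distrib_right mult_1)
    then have "(A *v (u *\<^sub>R x + v *\<^sub>R y) - b) $ j = u * (A *v x - b) $ j + v * (A *v y - b) $ j" for j
      by (simp add: matrix_vector_right_distrib matrix_vector_mult_scaleR algebra_simps)
    then have "?R (u *\<^sub>R x + v *\<^sub>R y) =
        (\<Sum>j\<in>UNIV. u * (sign_of T j * (A *v x - b) $ j) + v * (sign_of T j * (A *v y - b) $ j)) - \<sigma>"
      by (simp only: distrib_left mult.left_commute)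
    also have "\<dots> = u * ?R x + v * ?R y + (u + v - 1) * \<sigma>"
      unfolding sum.distrib sum_distrib_left[symmetric] by (simp only: algebra_simps)
    finally show "u * ?R x + v * ?R y \<le> ?R (u *\<^sub>R x + v *\<^sub>R y)"
      using uv by simp
  qed
  \<comment> \<open>The cell forces \<open>?R \<ge> 0\<close> if \<open>k = 1\<close> and
    \<open>?R \<le> 0\<close> if \<open>k = -1\<close>, so the positive part is \<open>?R\<close> or
    \<open>0\<close> throughout.\<close>
  have "concave_on ?C (\<lambda>x. if k = 1 then ?R x else 0)"
    using R by (cases "k = 1") (simp_all add: concave_on_const cvx)
  moreover have "pos_part (l1_norm (A *v x - b) - \<sigma>) = (if k = 1 then ?R x else 0)"
    if "x \<in> ?C" for x
  proof -
    have "l1_norm (A *v x - b) - \<sigma> = ?R x"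
      using that unfolding l1_norm_def sign_cell_def by (auto intro!: sum.cong abs_eq_sign_of)
    then show ?thesis
      using that assms(4) by (auto simp: pos_part_def sign_cell_def)
  qed
  ultimately have "concave_on ?C (\<lambda>x. pos_part (l1_norm (A *v x - b) - \<sigma>))"
    by (rule concave_on_cong[rotated])
  then show ?thesis
    unfolding penalty_objective_def[abs_def]
    using lp assms(3) by (intro concave_on_add concave_on_cmul) auto
qed

text \<open>The cells do not involve \<open>lam\<close>, so one finite set \<open>V\<close> serves
  all \<open>lam\<close> at once; this later allows \<open>lamstar\<close> to be read off from
  \<open>V\<close>.\<close>

lemma penalty_objective_vertices:
  fixes A :: "real ^ 'n ^ 'm"
  assumes "0 \<le> p" "p \<le> 1" "polytope Q"
  obtains V where "finite V" "V \<subseteq> Q"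
    "\<And>lam y. 0 \<le> lam \<Longrightarrow> y \<in> Q \<Longrightarrow>
      \<exists>v\<in>V. penalty_objective p A b \<sigma> lam v \<le> penalty_objective p A b \<sigma> lam y"
proof -
  define cell where "cell = (\<lambda>(S, T, k). Q \<inter> sign_cell A b \<sigma> S T k)"
  define I where "I = (UNIV :: 'n set set) \<times> (UNIV :: 'm set set) \<times> {-1, 1 :: real}"
  have "polytope (cell c)" for c
    unfolding cell_def
    by (cases c) (auto intro: polytope_Int_polyhedron assms(3) polyhedron_sign_cell)
  then obtain W where W: "\<And>c. finite (W c)" "\<And>c. cell c = convex hull (W c)"
    unfolding polytope_def by metis
  show thesis
  proof
    show "finite (\<Union>c\<in>I. W c)"
      using W(1) by (auto simp: I_def)
    have "W c \<subseteq> Q" for c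
      using hull_subset[of "W c" convex] W(2)[of c] by (auto simp: cell_def split: prod.splits)
    then show "(\<Union>c\<in>I. W c) \<subseteq> Q"
      by blast
    fix lam :: real and y
    assume "0 \<le> lam" "y \<in> Q"
    obtain S T k where k: "k \<in> {-1, 1}" and y: "y \<in> sign_cell A b \<sigma> S T k"
      by (rule sign_cell_cover)
    let ?c = "(S, T, k)"
    have "concave_on (cell ?c) (penalty_objective p A b \<sigma> lam)"
      using concave_on_sign_cell[OF assms(1,2) \<open>0 \<le> lam\<close> k, of A b \<sigma> S T] polytope_imp_convex[OF assms(3)]
      by (auto simp: cell_def concave_on_iff convex_Int)
    moreover have "y \<in> cell ?c"
      using \<open>y \<in> Q\<close> y by (simp add: cell_def)
    ultimately obtain v where "v \<in> W ?c"
      "penalty_objective p A b \<sigma> lam v \<le> penalty_objective p A b \<sigma> lam y"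
      using concave_on_convex_hull_vertex[OF W(1)] W(2) by metis
    moreover have "?c \<in> I"
      using k by (simp add: I_def)
    ultimately show "\<exists>v\<in>(\<Union>c\<in>I. W c).
        penalty_objective p A b \<sigma> lam v \<le> penalty_objective p A b \<sigma> lam y"
      by blast
  qed
qed

theorem theoremC1:
  fixes p \<sigma> :: real
    and A :: "real ^ 'n ^ 'm"
    and b :: "real ^ 'm"
    and xstar :: "real ^ 'n"
  assumes "0 < p" and "p < 1"
    and "\<sigma> \<ge> 0"
    and "l1_feasible A b \<sigma> \<noteq> {}"
    and "l1_norm b > \<sigma>"
    and "local_minimizer_on (lp_pow p) (l1_feasible A b \<sigma>) xstar"
  shows "\<exists>lamstar>0. \<forall>lam\<ge>lamstar.
           local_minimizer_on (penalty_objective p A b \<sigma> lam) UNIV xstar"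
proof -
  let ?F = "penalty_objective p A b \<sigma>"
  define g where "g x = pos_part (l1_norm (A *v x - b) - \<sigma>)" for x
  have F: "?F lam x = lp_pow p x + lam * g x" for lam x
    by (simp add: penalty_objective_def g_def)
  have g_nonneg: "0 \<le> g x" and g_feasible: "g x = 0 \<longleftrightarrow> x \<in> l1_feasible A b \<sigma>" for x
    by (auto simp: g_def pos_part_def l1_feasible_def)
  have lp_nonneg: "0 \<le> lp_pow p x" for x :: "real ^ 'n"
    by (simp add: lp_pow_def sum_nonneg)
  obtain \<epsilon> where "\<epsilon> > 0" and feas: "xstar \<in> l1_feasible A b \<sigma>"
    and min: "\<And>y. y \<in> l1_feasible A b \<sigma> \<Longrightarrow> dist y xstar < \<epsilon> \<Longrightarrow> lp_pow p xstar \<le> lp_pow p y"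
    using assms(6) by (auto simp: local_minimizer_on_def)
  \<comment> \<open>A box is used because it is a polytope; lying in the \<epsilon>-ball, it puts
    all feasible points of \<open>V\<close> within reach of \<open>min\<close>.\<close>
  obtain l u where box: "xstar \<in> box l u" "cbox l u \<subseteq> ball xstar \<epsilon>"
    using open_contains_cbox[OF open_ball centre_in_ball[THEN iffD2, OF \<open>\<epsilon> > 0\<close>]] by metis
  obtain \<delta> where "\<delta> > 0" and \<delta>: "ball xstar \<delta> \<subseteq> box l u"
    using openE[OF open_box box(1)] .
  obtain V where V: "finite V" "V \<subseteq> cbox l u"
    "\<And>lam y. 0 \<le> lam \<Longrightarrow> y \<in> cbox l u \<Longrightarrow> \<exists>v\<in>V. ?F lam v \<le> ?F lam y"
    using penalty_objective_vertices[of p "cbox l u" A b \<sigma>] polytope_interval assms(1,2)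
    by (metis less_imp_le)
  \<comment> \<open>Feasible vertices contribute the junk value \<open>lp_pow p xstar / 0 = 0\<close> to this sum.\<close>
  define lamstar where "lamstar = 1 + (\<Sum>v\<in>V. lp_pow p xstar / g v)"
  have quot_nonneg: "0 \<le> lp_pow p xstar / g v" for v
    by (simp add: lp_nonneg g_nonneg)
  \<comment> \<open>The summand 1 keeps \<open>lamstar\<close> positive even when \<open>V\<close>
    has no infeasible point.\<close>
  have "lamstar > 0"
    unfolding lamstar_def by (intro add_pos_nonneg sum_nonneg quot_nonneg) auto
  moreover have "local_minimizer_on (?F lam) UNIV xstar" if lam: "lamstar \<le> lam" for lam
  proof -
    have vertex: "?F lam xstar \<le> ?F lam v" if "v \<in> V" for v
    proof (cases "v \<in> l1_feasible A b \<sigma>")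
      case True
      moreover have "dist v xstar < \<epsilon>"
        using that V(2) box(2) by (auto simp: dist_commute)
      ultimately show ?thesis
        using min[of v] g_feasible[of v] g_feasible[of xstar] feas by (simp add: F)
    next
      case False
      then have "0 < g v"
        using g_feasible[of v] g_nonneg[of v] by simp
      \<comment> \<open>One nonnegative summand is at most the whole sum. Hence
        \<open>lam * g v\<close> alone already reaches \<open>lp_pow p xstar\<close>, the value of
        \<open>?F lam\<close> at \<open>xstar\<close>.\<close>
      have "lp_pow p xstar / g v \<le> lam"
        using member_le_sum[OF that, of "\<lambda>v. lp_pow p xstar / g v"] quot_nonneg V(1) lam
        by (simp add: lamstar_def)
      then show ?thesis
        using \<open>0 < g v\<close> lp_nonneg[of v] g_feasible[of xstar] feas by (simp add: F field_simps)
    qed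
    \<comment> \<open>The radius \<delta> is independent of \<open>lam\<close>; the bound passes
      through a point \<open>v\<close> of \<open>V\<close> with
      \<open>?F lam v \<le> ?F lam y\<close>.\<close>
    have "?F lam xstar \<le> ?F lam y" if "dist y xstar < \<delta>" for y
    proof -
      have "y \<in> cbox l u"
        using that \<delta> box_subset_cbox by (force simp: dist_commute)
      then show ?thesis
        using V(3)[of lam y] vertex lam \<open>lamstar > 0\<close> by fastforce
    qed
    then show ?thesis
      using \<open>\<delta> > 0\<close> by (auto simp: local_minimizer_on_def)
  qed
  ultimately show ?thesis
    by blast
qed

end
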